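(* Let $k>0$, let $G$ be analytic in a neighbourhood of $(k,0)$, and let $\delta$, $\chi_1$, $v^+$, $v^-$ and $$v(0,R)=\frac{i}{4\pi}v^+(R)+\frac1{4\pi}v^-(R)$$ be as defined in the context. Then, for every $N\in\mathbb{N}$, $$v(0,R)=\mathcal O(R^{-N})\qquad\text{as }R\to\infty .$$
   Context: $G=G(\gamma,s)$ is (complex-)analytic in both variables in a neighbourhood of $(k,0)$ in $\mathbb{C}^2$. The number $\delta\in(0,k)$ is chosen sufficiently small that this neighbourhood contains all points $(\sqrt{k^2-s^2},s)$ with $0\le s\le a_+$ and all points $(\sqrt{k^2+s^2},is)$ with $0\le s\le a_-$, where $$a_+=\sqrt{2k\delta-\delta^2},\qquad a_-=\sqrt{2k\delta+\delta^2}.$$ The cutoff $\chi_1\in C_0^\infty(\mathbb{R})$ satisfies $\operatorname{supp}\chi_1\subset(-\delta,\delta)$ and $\chi_1=1$ in a neighbourhood of $0$. Define for $R>0$ $$v^+(R)=\int_0^{a_+}e^{iRs}\,\frac{\chi_1\bigl(\sqrt{k^2-s^2}-k\bigr)\,G\bigl(\sqrt{k^2-s^2},s\bigr)}{\sqrt{k^2-s^2}}\,ds,$$ $$v^-(R)=\int_0^{a_-}e^{-Rs}\,\frac{\chi_1\bigl(\sqrt{k^2+s^2}-k\bigr)\,G\bigl(\sqrt{k^2+s^2},is\bigr)}{\sqrt{k^2+s^2}}\,ds .$$ Equivalently, $v(0,R)=\frac{i}{4\pi}\int_{k-\delta}^{k+\delta}\frac{e^{iR\sqrt{k^2-\gamma^2}}\chi_1(\gamma-k)G(\gamma,\sqrt{k^2-\gamma^2})}{\sqrt{k^2-\gamma^2}}\,d\gamma$,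 with $\sqrt{k^2-\gamma^2}=i\sqrt{\gamma^2-k^2}$ for $\gamma>k$. This is the contribution near the tangency point $(k,0)$ to the outgoing solution of $-\Delta u-k^2u=f$ in $\mathbb{R}^2$ at $x=(0,R)$, with $\widehat f(\gamma,s)=\chi_1(\gamma-k)G(\gamma,s)$. *)

theory Defs
  imports "HOL-Analysis.Analysis" "HOL-Library.Landau_Symbols"
begin

text \<open>
  Analyticity in two complex variables: around every point of the set, the function is the sum
  of an (unconditionally, hence absolutely) convergent double power series on a bidisc.
\<close>

definition analytic2_on :: "(complex \<times> complex \<Rightarrow> complex) \<Rightarrow> (complex \<times> complex) set \<Rightarrow> bool"
  where "analytic2_on G U \<longleftrightarrow>
    (\<forall>(a, b) \<in> U. \<exists>r > 0. \<exists>c :: nat \<times> nat \<Rightarrow> complex. \<forall>z \<in> ball a r. \<forall>w \<in> ball b r.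
       ((\<lambda>(m, n). c (m, n) * (z - a) ^ m * (w - b) ^ n) has_sum G (z, w)) UNIV)"

text \<open>The sequence \<open>D\<close> lists the successive derivatives of \<open>f\<close>.\<close>

definition smooth_on_line :: "(real \<Rightarrow> complex) \<Rightarrow> bool"
  where "smooth_on_line f \<longleftrightarrow>
    (\<exists>D :: nat \<Rightarrow> real \<Rightarrow> complex. D 0 = f \<and>
       (\<forall>n x. (D n has_vector_derivative D (Suc n) x) (at x)))"

definition supp :: "(real \<Rightarrow> complex) \<Rightarrow> real set"
  where "supp f = closure {x. f x \<noteq> 0}"

definition test_function :: "(real \<Rightarrow> complex) \<Rightarrow> bool"
  where "test_function f \<longleftrightarrow> smooth_on_line f \<and> compact (supp f)"

definition a_plus :: "real \<Rightarrow> real \<Rightarrow> real"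
  where "a_plus k \<delta> = sqrt (2 * k * \<delta> - \<delta>\<^sup>2)"

definition a_minus :: "real \<Rightarrow> real \<Rightarrow> real"
  where "a_minus k \<delta> = sqrt (2 * k * \<delta> + \<delta>\<^sup>2)"

definition v_plus ::
  "real \<Rightarrow> real \<Rightarrow> (real \<Rightarrow> complex) \<Rightarrow> (complex \<times> complex \<Rightarrow> complex) \<Rightarrow> real \<Rightarrow> complex"
  where "v_plus k \<delta> chi G R =
    integral {0..a_plus k \<delta>} (\<lambda>s. exp (\<i> * of_real (R * s)) *
      (chi (sqrt (k\<^sup>2 - s\<^sup>2) - k) * G (of_real (sqrt (k\<^sup>2 - s\<^sup>2)), of_real s)
        / of_real (sqrt (k\<^sup>2 - s\<^sup>2))))"

definition v_minus ::
  "real \<Rightarrow> real \<Rightarrow> (real \<Rightarrow> complex) \<Rightarrow> (complex \<times> complex \<Rightarrow> complex) \<Rightarrow> real \<Rightarrow> complex"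
  where "v_minus k \<delta> chi G R =
    integral {0..a_minus k \<delta>} (\<lambda>s. of_real (exp (- R * s)) *
      (chi (sqrt (k\<^sup>2 + s\<^sup>2) - k) * G (of_real (sqrt (k\<^sup>2 + s\<^sup>2)), \<i> * of_real s)
        / of_real (sqrt (k\<^sup>2 + s\<^sup>2))))"

text \<open>The value at the point \<open>x = (0, R)\<close>.\<close>

definition v_at ::
  "real \<Rightarrow> real \<Rightarrow> (real \<Rightarrow> complex) \<Rightarrow> (complex \<times> complex \<Rightarrow> complex) \<Rightarrow> real \<Rightarrow> complex"
  where "v_at k \<delta> chi G R =
    \<i> / (4 * of_real pi) * v_plus k \<delta> chi G R + 1 / (4 * of_real pi) * v_minus k \<delta> chi G R"

end

theory Submission
  imports Defs "HOL-Complex_Analysis.Complex_Analysis"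
begin

text \<open>
  Put \<open>q z = csqrt (k\<^sup>2 - z\<^sup>2)\<close>, \<open>\<phi> z = q z - k\<close> and \<open>h z = G (q z, z) / q z\<close>, which are holomorphic
  near the two segments from \<open>0\<close> to \<open>a_plus\<close> and from \<open>0\<close> to \<open>\<i> * a_minus\<close>. Since \<open>\<phi>\<close> is real on
  both segments, \<open>K z = chi (\<phi> z) * h z\<close> makes sense there, and the value in question is
  \<open>\<i> / (4\<pi>)\<close> times the difference of the integrals of \<open>exp (\<i> R z) * K z\<close> over the two segments.
  If \<open>K\<close> were holomorphic between the segments, Cauchy's theorem would move one onto the other,
  up to their far ends. The cutoff destroys holomorphy, but what is left of it suffices:
  differentiating \<open>K\<close> along either segment, by the chain rule, gives one and the same formula
  for its \<open>j\<close>-th complex derivative \<open>K\<^sub>j\<close>, a sum of terms \<open>chi\<^sup>(\<^sup>n\<^sup>) (\<phi> z)\<close> times a holomorphic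
  function (\<open>cutoff_deriv_has_vector_derivative\<close>).

  Every integration by parts produces the factor \<open>\<i> / R\<close> and a boundary term
  (\<open>ray_integral_by_parts\<close>). At the far ends all \<open>K\<^sub>j\<close> vanish because the support of \<open>chi\<close> lies in
  the open interval; at the common starting point \<open>0\<close> both segments contribute the same value
  \<open>K\<^sub>j 0\<close>, which cancels in the difference. Hence after \<open>N\<close> steps the difference is \<open>(\<i> / R) ^ N\<close>
  times a bounded function (\<open>ray_integrals_difference_bigo\<close>).
\<close>

section \<open>Holomorphic curves in the domain of a double power series\<close>

text \<open>
  The double series converges absolutely at the corner of a smaller bidisc, so by the Weierstrass
  M-test the series evaluated along the curve is, locally, a uniform limit of holomorphic
  finite sums.
\<close>

lemma analytic2_on_compose:
  assumes G: "analytic2_on G U" and W: "open W"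
    and f: "f holomorphic_on W" and g: "g holomorphic_on W"
    and U: "\<And>z. z \<in> W \<Longrightarrow> (f z, g z) \<in> U"
  shows "(\<lambda>z. G (f z, g z)) holomorphic_on W"
proof -
  have "(\<lambda>z. G (f z, g z)) field_differentiable (at z0)" if z0: "z0 \<in> W" for z0
  proof -
    from G U[OF z0] obtain r c where r: "r > 0"
      and sums: "\<And>z w. z \<in> ball (f z0) r \<Longrightarrow> w \<in> ball (g z0) r \<Longrightarrow>
        ((\<lambda>(m, n). c (m, n) * (z - f z0) ^ m * (w - g z0) ^ n) has_sum G (z, w)) UNIV"
      unfolding analytic2_on_def by fastforce
    define \<rho> where "\<rho> = r / 2"
    have \<rho>: "0 < \<rho>" "\<rho> < r" using r by (auto simp: \<rho>_def)
    define monomial where "monomial = (\<lambda>p z. c p * (f z - f z0) ^ fst p * (g z - g z0) ^ snd p)"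
    define M where "M = (\<lambda>p. norm (c p) * \<rho> ^ fst p * \<rho> ^ snd p)"
    define V where "V = (W \<inter> f -` ball (f z0) \<rho>) \<inter> (W \<inter> g -` ball (g z0) \<rho>)"
    have "open V" unfolding V_def
      by (intro open_Int continuous_open_preimage holomorphic_on_imp_continuous_on f g W open_ball)
    moreover have "z0 \<in> V" using z0 \<rho> by (auto simp: V_def)
    ultimately obtain e where e: "e > 0" "cball z0 e \<subseteq> V"
      using open_contains_cball by blast
    (* The corner of the closed bidisc of radius \<rho>, where the absolute values of the terms
       dominate those on the whole bidisc. *)
    have "(\<lambda>p. c p * of_real \<rho> ^ fst p * of_real \<rho> ^ snd p) summable_on UNIV"
      using sums[of "f z0 + of_real \<rho>" "g z0 + of_real \<rho>"] \<rho>
      by (auto simp: dist_norm case_prod_unfold has_sum_imp_summable)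
    then have M: "M summable_on UNIV"
      using \<rho> unfolding M_def summable_on_iff_abs_summable_on_complex
      by (simp add: norm_mult norm_power)
    have hol_monomial: "monomial p holomorphic_on cball z0 e" for p
    proof -
      have "monomial p holomorphic_on W" unfolding monomial_def
        by (intro holomorphic_intros f g)
      then show ?thesis by (rule holomorphic_on_subset) (use e in \<open>auto simp: V_def\<close>)
    qed
    have lim: "uniform_limit (cball z0 e) (\<lambda>X z. \<Sum>p\<in>X. monomial p z) (\<lambda>z. G (f z, g z))
            (finite_subsets_at_top UNIV)"
    proof (rule Weierstrass_m_test_general')
      fix p z assume "z \<in> cball z0 e"
      then have "z \<in> V" using e by blast
      then show "norm (monomial p z) \<le> M p" unfolding monomial_def M_def norm_mult norm_power
        by (intro mult_mono power_mono mult_nonneg_nonneg)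
          (use \<rho> in \<open>auto simp: V_def dist_norm norm_minus_commute\<close>)
    next
      fix z assume "z \<in> cball z0 e"
      then have "z \<in> V" using e by blast
      then show "((\<lambda>p. monomial p z) has_sum G (f z, g z)) UNIV"
        using sums[of "f z" "g z"] \<rho> by (auto simp: V_def monomial_def case_prod_unfold)
    qed (rule M)
    have hol: "\<forall>\<^sub>F X in finite_subsets_at_top UNIV.
        continuous_on (cball z0 e) (\<lambda>z. \<Sum>p\<in>X. monomial p z) \<and>
        (\<lambda>z. \<Sum>p\<in>X. monomial p z) holomorphic_on ball z0 e"
      by (intro always_eventually allI conjI holomorphic_on_imp_continuous_on holomorphic_on_sum
          holomorphic_on_subset[OF hol_monomial ball_subset_cball] hol_monomial)
    have "(\<lambda>z. G (f z, g z)) holomorphic_on ball z0 e"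
      by (rule holomorphic_uniform_limit[OF hol lim finite_subsets_at_top_neq_bot])
    then show ?thesis
      using e(1) holomorphic_on_imp_differentiable_at by (metis centre_in_ball open_ball)
  qed
  then show ?thesis
    by (simp add: holomorphic_on_def field_differentiable_at_within)
qed

section \<open>Oscillatory and Laplace integrals along rays\<close>

text \<open>
  The contour integral of \<open>exp (\<i> R z) * F z\<close> over the segment from \<open>0\<close> to \<open>c * a\<close>, where
  \<open>F (c * s) = f s\<close>. Only the values on the segment enter, so \<open>f\<close> is a function of the real
  parameter.
\<close>

definition ray_integral :: "complex \<Rightarrow> real \<Rightarrow> (real \<Rightarrow> complex) \<Rightarrow> real \<Rightarrow> complex"
  where "ray_integral c a f R = c * integral {0..a} (\<lambda>s. exp (\<i> * of_real R * c * of_real s) * f s)"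

text \<open>
  With \<open>c * f'\<close> as the parameter derivative, \<open>f'\<close> is the derivative with respect to \<open>z = c * s\<close>.
  In this form neither the factor \<open>\<i> / R\<close> nor the boundary term \<open>f 0\<close> depends on the direction
  \<open>c\<close>, which is what makes the boundary terms of two rays cancel.
\<close>

lemma ray_integral_by_parts:
  assumes a: "0 \<le> a" and c: "c \<noteq> 0" and R: "R > 0"
    and der: "\<And>s. s \<in> {0..a} \<Longrightarrow> (f has_vector_derivative c * f' s) (at s within {0..a})"
    and cont: "continuous_on {0..a} f'" and end0: "f a = 0"
  shows "ray_integral c a f R = \<i> / of_real R * (f 0 + ray_integral c a f' R)"
proof -
  define e where "e = (\<lambda>s::real. exp (\<i> * of_real R * c * of_real s))"
  have contf: "continuous_on {0..a} f"
    by (rule continuous_on_vector_derivative[OF der])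
  have conte: "continuous_on {0..a} e"
    unfolding e_def by (intro continuous_intros)
  have e': "(e has_vector_derivative \<i> * of_real R * c * e s) (at s within {0..a})" for s
  proof -
    have "((\<lambda>z. exp (\<i> * of_real R * c * z)) has_field_derivative
        \<i> * of_real R * c * e s) (at (of_real s))"
      by (auto intro!: derivative_eq_intros simp: e_def)
    from has_vector_derivative_real_field[OF this] show ?thesis unfolding e_def .
  qed
  have "((\<lambda>s. e s * f s) has_vector_derivative
      (e s * (c * f' s) + \<i> * of_real R * c * e s * f s)) (at s within {0..a})"
    if "s \<in> {0..a}" for s
    by (rule has_vector_derivative_mult[OF e' der[OF that]])
  from fundamental_theorem_of_calculus[OF a this]
  have "integral {0..a} (\<lambda>s. e s * (c * f' s) + \<i> * of_real R * c * e s * f s)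
      = e a * f a - e 0 * f 0"
    by (intro integral_unique) auto
  moreover have "integral {0..a} (\<lambda>s. e s * (c * f' s) + \<i> * of_real R * c * e s * f s)
     = c * integral {0..a} (\<lambda>s. e s * f' s) + \<i> * of_real R * (c * integral {0..a} (\<lambda>s. e s * f s))"
  proof -
    have "(\<lambda>s. e s * f' s) integrable_on {0..a}" "(\<lambda>s. e s * f s) integrable_on {0..a}"
      by (intro integrable_continuous_real continuous_intros conte contf cont)+
    from has_integral_add[OF
        has_integral_mult_right[OF integrable_integral[OF this(1)], of c]
        has_integral_mult_right[OF integrable_integral[OF this(2)], of "\<i> * of_real R * c"]]
    show ?thesis by (intro integral_unique) (simp add: algebra_simps)
  qed
  ultimately have "ray_integral c a f' R + \<i> * of_real R * ray_integral c a f R = - f 0"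
    unfolding ray_integral_def e_def by (simp add: end0)
  then have "\<i> * of_real R * ray_integral c a f R = - (f 0 + ray_integral c a f' R)"
    by (simp add: algebra_simps eq_neg_iff_add_eq_0)
  then have "\<i> * (\<i> * of_real R * ray_integral c a f R) = - (\<i> * (f 0 + ray_integral c a f' R))"
    by (simp only: mult_minus_right)
  then show ?thesis using R by (simp add: field_simps)
qed

text \<open>
  In the closed upper half plane \<open>exp (\<i> R z)\<close> has modulus at most \<open>1\<close>, whence a bound uniform
  in \<open>R\<close>.
\<close>

lemma ray_integral_bounded:
  assumes a: "0 \<le> a" and c: "Im c \<ge> 0" and cont: "continuous_on {0..a} f"
  obtains B where "\<And>R. R > 0 \<Longrightarrow> norm (ray_integral c a f R) \<le> B"
proof -
  obtain C where C: "\<And>s. s \<in> {0..a} \<Longrightarrow> norm (f s) \<le> C"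
    using compact_imp_bounded[OF compact_continuous_image[OF cont compact_Icc]]
    unfolding bounded_iff by blast
  show ?thesis
  proof
    fix R :: real assume R: "R > 0"
    have "norm (integral {0..a} (\<lambda>s. exp (\<i> * of_real R * c * of_real s) * f s)) \<le> C * (a - 0)"
    proof (rule integral_bound[OF a])
      show "continuous_on {0..a} (\<lambda>s. exp (\<i> * of_real R * c * of_real s) * f s)"
        by (intro continuous_intros cont)
    next
      fix s assume s: "s \<in> {0..a}"
      have "norm (exp (\<i> * of_real R * c * of_real s)) \<le> 1"
        using s R c by simp
      then show "norm (exp (\<i> * of_real R * c * of_real s) * f s) \<le> C"
        unfolding norm_mult using C[OF s] mult_mono[of _ 1 "norm (f s)" C] by fastforce
    qed
    then show "norm (ray_integral c a f R) \<le> norm c * (C * a)"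
      unfolding ray_integral_def norm_mult by (simp add: mult_left_mono)
  qed
qed

text \<open>
  The hypothesis \<open>start\<close> says that all derivatives of the two families agree at the common
  starting point. Each integration by parts therefore replaces the difference by \<open>\<i> / R\<close> times
  the difference for the next pair of derivatives.
\<close>

lemma ray_integrals_difference_bigo:
  fixes f g :: "nat \<Rightarrow> real \<Rightarrow> complex"
  assumes f: "0 \<le> a" "c \<noteq> 0" "Im c \<ge> 0"
      "\<And>j s. s \<in> {0..a} \<Longrightarrow> (f j has_vector_derivative c * f (Suc j) s) (at s within {0..a})"
      "\<And>j. f j a = 0"
    and g: "0 \<le> b" "d \<noteq> 0" "Im d \<ge> 0"
      "\<And>j s. s \<in> {0..b} \<Longrightarrow> (g j has_vector_derivative d * g (Suc j) s) (at s within {0..b})"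
      "\<And>j. g j b = 0"
    and start: "\<And>j. f j 0 = g j 0"
  shows "(\<lambda>R. ray_integral c a (f 0) R - ray_integral d b (g 0) R) \<in> O[at_top](\<lambda>R. of_real (1 / R ^ N))"
proof -
  define \<Delta> where "\<Delta> = (\<lambda>j R. ray_integral c a (f j) R - ray_integral d b (g j) R)"
  have cf: "continuous_on {0..a} (f j)" for j
    by (rule continuous_on_vector_derivative[OF f(4)])
  have cg: "continuous_on {0..b} (g j)" for j
    by (rule continuous_on_vector_derivative[OF g(4)])
  have step: "\<Delta> j R = \<i> / of_real R * \<Delta> (Suc j) R" if "R > 0" for j R
    using ray_integral_by_parts[where f = "f j" and f' = "f (Suc j)", OF f(1,2) that f(4) cf f(5)]
      ray_integral_by_parts[where f = "g j" and f' = "g (Suc j)", OF g(1,2) that g(4) cg g(5)]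
    unfolding \<Delta>_def start by (simp only: distrib_left right_diff_distrib add_diff_cancel_left)
  have iter: "\<Delta> 0 R = (\<i> / of_real R) ^ N * \<Delta> N R" if "R > 0" for R
  proof (induction N)
    case (Suc n)
    then show ?case using step[OF that, of n] by simp
  qed simp
  obtain B where B: "\<And>R. R > 0 \<Longrightarrow> norm (ray_integral c a (f N) R) \<le> B"
    using ray_integral_bounded[OF f(1,3) cf[of N]] by blast
  obtain B' where B': "\<And>R. R > 0 \<Longrightarrow> norm (ray_integral d b (g N) R) \<le> B'"
    using ray_integral_bounded[OF g(1,3) cg[of N]] by blast
  have "norm (\<Delta> 0 R) \<le> (B + B') * norm (of_real (1 / R ^ N) :: complex)" if R: "R > 0" for R
  proof -
    have "norm (\<Delta> N R) \<le> B + B'"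
      unfolding \<Delta>_def using norm_triangle_ineq4 B[OF R] B'[OF R] by (smt (verit))
    then show ?thesis using R unfolding iter[OF R]
      by (simp add: norm_mult norm_power norm_divide power_divide divide_simps)
  qed
  then show ?thesis unfolding \<Delta>_def
    by (intro bigoI[where c = "B + B'"] eventually_mono[OF eventually_gt_at_top[of 0]])
qed

section \<open>Derivatives of a cut off holomorphic function along a ray\<close>

lemma derivatives_vanish_where_locally_constant:
  fixes D :: "nat \<Rightarrow> real \<Rightarrow> complex"
  assumes D: "\<And>n x. (D n has_vector_derivative D (Suc n) x) (at x)"
    and S: "open S" and const: "\<And>x. x \<in> S \<Longrightarrow> D 0 x = C" and x: "x \<in> S"
  shows "D (Suc n) x = 0"
  using x
proof (induction n arbitrary: x)
  have *: "D (Suc n) x = 0" if "x \<in> S" and "\<And>y. y \<in> S \<Longrightarrow> D n y = K" for n x K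
  proof -
    have "((\<lambda>_. K) has_vector_derivative D (Suc n) x) (at x)"
      by (rule has_vector_derivative_transform_within_open[OF D S]) (use that in auto)
    then show ?thesis using vector_derivative_at by fastforce
  qed
  {
    case 0
    show ?case using *[OF 0, of 0 C] const by simp
  next
    case (Suc n)
    show ?case using *[OF Suc.prems, of "Suc n" 0] Suc.IH by simp
  }
qed

text \<open>
  Formal differentiation of \<open>\<chi> (\<phi> z) * h z\<close> by the product and chain rules, as if \<open>\<chi>\<close> were
  holomorphic, gives after \<open>j\<close> steps \<open>\<Sum>n\<le>j. \<chi>\<^sup>(\<^sup>n\<^sup>) (\<phi> z) * g\<^sub>j\<^sub>,\<^sub>n z\<close>. Comparing coefficients of
  \<open>\<chi>\<^sup>(\<^sup>n\<^sup>)\<close> in two consecutive steps yields the recursion for the holomorphic functions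
  \<open>g\<^sub>j\<^sub>,\<^sub>n = cutoff_coeff \<phi> h j n\<close>.
\<close>

primrec cutoff_coeff :: "(complex \<Rightarrow> complex) \<Rightarrow> (complex \<Rightarrow> complex) \<Rightarrow> nat \<Rightarrow> nat \<Rightarrow> complex \<Rightarrow> complex"
  where
    "cutoff_coeff \<phi> h 0 = (\<lambda>n z. if n = 0 then h z else 0)"
  | "cutoff_coeff \<phi> h (Suc j) = (\<lambda>n z. deriv (cutoff_coeff \<phi> h j n) z
        + (case n of 0 \<Rightarrow> 0 | Suc m \<Rightarrow> deriv \<phi> z * cutoff_coeff \<phi> h j m z))"

text \<open>
  The \<open>j\<close>-th formal derivative, with \<open>D n\<close> for the \<open>n\<close>-th derivative of \<open>\<chi>\<close>. It is meant for points
  with real \<open>\<phi> z\<close>; the real part only supplies an argument of real type.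
\<close>

definition cutoff_deriv ::
  "(nat \<Rightarrow> real \<Rightarrow> complex) \<Rightarrow> (complex \<Rightarrow> complex) \<Rightarrow> (complex \<Rightarrow> complex) \<Rightarrow> nat \<Rightarrow> complex \<Rightarrow> complex"
  where "cutoff_deriv D \<phi> h j z = (\<Sum>n\<le>j. D n (Re (\<phi> z)) * cutoff_coeff \<phi> h j n z)"

lemma cutoff_coeff_holomorphic:
  assumes "open W" "\<phi> holomorphic_on W" "h holomorphic_on W"
  shows "cutoff_coeff \<phi> h j n holomorphic_on W"
proof (induction j arbitrary: n)
  case 0
  then show ?case using assms by (cases n) auto
next
  case (Suc j)
  then show ?case using assms
    by (cases n) (auto intro!: holomorphic_intros holomorphic_deriv)
qed

lemma cutoff_coeff_eq_0: "j < n \<Longrightarrow> cutoff_coeff \<phi> h j n = (\<lambda>z. 0)"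
  by (induction j arbitrary: n) (auto split: nat.split)

text \<open>
  On a ray where \<open>\<phi>\<close> is real, the derivative of \<open>\<phi>\<close> along the ray is real too, so the chain rule
  for the merely smooth function \<open>\<chi>\<close> looks exactly like the one for a holomorphic function, and
  the formal derivatives are true derivatives, whatever the direction \<open>c\<close> of the ray.
\<close>

lemma cutoff_deriv_has_vector_derivative:
  assumes D: "\<And>n x. (D n has_vector_derivative D (Suc n) x) (at x)"
    and W: "open W" and \<phi>: "\<phi> holomorphic_on W" and h: "h holomorphic_on W"
    and a: "0 < a" and s: "s \<in> {0..a}"
    and ray: "\<And>s. s \<in> {0..a} \<Longrightarrow> c * of_real s \<in> W \<and> Im (\<phi> (c * of_real s)) = 0"
  shows "((\<lambda>s. cutoff_deriv D \<phi> h j (c * of_real s)) has_vector_derivative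
           c * cutoff_deriv D \<phi> h (Suc j) (c * of_real s)) (at s within {0..a})"
proof -
  let ?z = "c * of_real s" and ?F = "at s within {0..a}"
  have along_ray: "((\<lambda>s. f (c * of_real s)) has_vector_derivative c * deriv f ?z) ?F"
    if f: "f holomorphic_on W" for f
  proof -
    have "(f has_field_derivative deriv f ?z) (at (c * of_real s))"
      using holomorphic_derivI[OF f W] ray[OF s] by blast
    from DERIV_chain2[where g = "\<lambda>w. c * w", OF this, of c UNIV]
    have "((\<lambda>w. f (c * w)) has_field_derivative c * deriv f ?z) (at (of_real s))"
      using DERIV_cmult_Id[of c] by (simp add: mult.commute[of c "deriv f ?z"])
    from has_vector_derivative_real_field[OF this] show ?thesis .
  qed
  (* The direction derivative of \<phi> is real: its imaginary part is the derivative of the zero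
     function. The one-sided derivatives at the ends are unique because 0 < a. *)
  have re: "((\<lambda>s. Re (\<phi> (c * of_real s))) has_real_derivative Re (c * deriv \<phi> ?z)) ?F"
    using bounded_linear.has_vector_derivative[OF bounded_linear_Re along_ray[OF \<phi>]]
    by (simp add: has_real_derivative_iff_has_vector_derivative)
  have "((\<lambda>s. Im (\<phi> (c * of_real s))) has_vector_derivative Im (c * deriv \<phi> ?z)) ?F"
    by (rule bounded_linear.has_vector_derivative[OF bounded_linear_Im along_ray[OF \<phi>]])
  moreover have "((\<lambda>s. Im (\<phi> (c * of_real s))) has_vector_derivative 0) ?F"
    by (rule has_vector_derivative_transform[OF s _ has_vector_derivative_const[of 0]])
      (use ray in simp)
  ultimately have "Im (c * deriv \<phi> ?z) = 0"
    using vector_derivative_unique_within_closed_interval[of 0 a s] a s by auto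
  then have real: "of_real (Re (c * deriv \<phi> ?z)) = c * deriv \<phi> ?z"
    by (simp add: complex_eq_iff)
  have chi: "((\<lambda>s. D n (Re (\<phi> (c * of_real s)))) has_vector_derivative
      (c * deriv \<phi> ?z) * D (Suc n) (Re (\<phi> ?z))) ?F" for n
    using vector_diff_chain_within[OF re[unfolded has_real_derivative_iff_has_vector_derivative]
        has_vector_derivative_at_within[OF D[of n]]]
    by (simp only: o_def scaleR_conv_of_real real)
  have "((\<lambda>s. cutoff_deriv D \<phi> h j (c * of_real s)) has_vector_derivative
      (\<Sum>n\<le>j. D n (Re (\<phi> ?z)) * (c * deriv (cutoff_coeff \<phi> h j n) ?z)
         + (c * deriv \<phi> ?z) * D (Suc n) (Re (\<phi> ?z)) * cutoff_coeff \<phi> h j n ?z)) ?F"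
    unfolding cutoff_deriv_def
    by (intro has_vector_derivative_sum has_vector_derivative_mult chi along_ray
        cutoff_coeff_holomorphic[OF W \<phi> h])
  also have "(\<Sum>n\<le>j. D n (Re (\<phi> ?z)) * (c * deriv (cutoff_coeff \<phi> h j n) ?z)
         + (c * deriv \<phi> ?z) * D (Suc n) (Re (\<phi> ?z)) * cutoff_coeff \<phi> h j n ?z)
      = c * ((\<Sum>n\<le>j. D n (Re (\<phi> ?z)) * deriv (cutoff_coeff \<phi> h j n) ?z)
         + (\<Sum>n\<le>j. D (Suc n) (Re (\<phi> ?z)) * (deriv \<phi> ?z * cutoff_coeff \<phi> h j n ?z)))"
    by (simp add: sum.distrib sum_distrib_left algebra_simps)
  also have "(\<Sum>n\<le>j. D n (Re (\<phi> ?z)) * deriv (cutoff_coeff \<phi> h j n) ?z)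
      = (\<Sum>n\<le>Suc j. D n (Re (\<phi> ?z)) * deriv (cutoff_coeff \<phi> h j n) ?z)"
    by (simp add: cutoff_coeff_eq_0)
  also have "\<dots> + (\<Sum>n\<le>j. D (Suc n) (Re (\<phi> ?z)) * (deriv \<phi> ?z * cutoff_coeff \<phi> h j n ?z))
      = cutoff_deriv D \<phi> h (Suc j) ?z"
    unfolding cutoff_deriv_def cutoff_coeff.simps sum.atMost_Suc_shift[of _ j]
    by (simp add: sum.distrib algebra_simps)
  finally show ?thesis .
qed

section \<open>Rapid decay of the contribution of the tangency point\<close>

theorem theorem3p2:
  fixes k \<delta> :: real
    and U :: "(complex \<times> complex) set"
    and G :: "complex \<times> complex \<Rightarrow> complex"
    and chi :: "real \<Rightarrow> complex"
    and N :: nat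
  assumes k_pos: "k > 0"
    and U_open: "open U"
    and U_center: "(of_real k, 0) \<in> U"
    and G_analytic: "analytic2_on G U"
    and delta_range: "0 < \<delta>" "\<delta> < k"
    and U_plus: "\<And>s. 0 \<le> s \<Longrightarrow> s \<le> a_plus k \<delta> \<Longrightarrow>
                   (of_real (sqrt (k\<^sup>2 - s\<^sup>2)), of_real s) \<in> U"
    and U_minus: "\<And>s. 0 \<le> s \<Longrightarrow> s \<le> a_minus k \<delta> \<Longrightarrow>
                   (of_real (sqrt (k\<^sup>2 + s\<^sup>2)), \<i> * of_real s) \<in> U"
    and chi_test: "test_function chi"
    and chi_supp: "supp chi \<subseteq> {-\<delta><..<\<delta>}"
    and chi_one: "\<forall>\<^sub>F x in nhds 0. chi x = 1"
  shows "(\<lambda>R. v_at k \<delta> chi G R) \<in> O[at_top](\<lambda>R. of_real (1 / R ^ N))"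
proof -
  obtain D where D0: "D 0 = chi" and D: "\<And>n x. (D n has_vector_derivative D (Suc n) x) (at x)"
    using chi_test unfolding test_function_def smooth_on_line_def by blast
  have D_at_end: "D n x = 0" if "x = \<delta> \<or> x = -\<delta>" for n x
  proof -
    have zero: "chi y = 0" if "y \<in> - supp chi" for y
      using that closure_subset[of "{x. chi x \<noteq> 0}"] unfolding supp_def by blast
    have x: "x \<in> - supp chi" using that chi_supp by auto
    have "open (- supp chi)" by (simp add: supp_def open_Compl)
    then have "D (Suc m) x = 0" for m
      by (rule derivatives_vanish_where_locally_constant[where D = D and C = 0, OF D _ _ x])
        (simp add: D0 zero)
    then show ?thesis using zero[OF x] by (cases n) (auto simp: D0)
  qed

  define q where "q = (\<lambda>z. csqrt ((of_real k)\<^sup>2 - z\<^sup>2))"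
  (* On W0 the argument of the square root stays off its branch cut. *)
  define W0 where "W0 = {z. Re ((of_real k)\<^sup>2 - z\<^sup>2) > 0}"
  define W where "W = W0 \<inter> (\<lambda>z. (q z, z)) -` U"
  define \<phi> where "\<phi> = (\<lambda>z. q z - of_real k)"
  define h where "h = (\<lambda>z. G (q z, z) / q z)"
  define K where "K = cutoff_deriv D \<phi> h"
  have "open W0" unfolding W0_def
    by (intro open_Collect_less continuous_intros)
  have q_hol0: "q holomorphic_on W0" unfolding q_def W0_def
    by (intro holomorphic_intros) (auto simp: complex_nonpos_Reals_iff)
  have W: "open W" unfolding W_def
    by (intro continuous_open_preimage continuous_intros \<open>open W0\<close> U_open
        holomorphic_on_imp_continuous_on[OF q_hol0])
  have q_hol: "q holomorphic_on W"
    by (rule holomorphic_on_subset[OF q_hol0]) (simp add: W_def)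
  have \<phi>: "\<phi> holomorphic_on W" unfolding \<phi>_def by (intro holomorphic_intros q_hol)
  have q_nz: "q z \<noteq> 0" if "z \<in> W" for z
  proof -
    have "Re ((of_real k)\<^sup>2 - z\<^sup>2) > 0" using that by (simp add: W_def W0_def)
    then have "(of_real k)\<^sup>2 - z\<^sup>2 \<noteq> 0" by fastforce
    then show ?thesis by (simp only: q_def csqrt_eq_0 not_False_eq_True)
  qed
  have h: "h holomorphic_on W" unfolding h_def
    by (intro holomorphic_intros q_hol analytic2_on_compose[OF G_analytic W])
      (auto simp: W_def q_nz)

  have a_plus_sq: "(a_plus k \<delta>)\<^sup>2 = 2 * k * \<delta> - \<delta>\<^sup>2" and a_plus_pos: "a_plus k \<delta> > 0"
  proof -
    have "\<delta> * \<delta> < k * \<delta>" "0 < k * \<delta>" using delta_range k_pos by auto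
    then have "2 * k * \<delta> - \<delta>\<^sup>2 > 0" by (simp add: power2_eq_square)
    then show "(a_plus k \<delta>)\<^sup>2 = 2 * k * \<delta> - \<delta>\<^sup>2" "a_plus k \<delta> > 0" by (auto simp: a_plus_def)
  qed
  have a_minus_sq: "(a_minus k \<delta>)\<^sup>2 = 2 * k * \<delta> + \<delta>\<^sup>2" and a_minus_pos: "a_minus k \<delta> > 0"
  proof -
    have "2 * k * \<delta> + \<delta>\<^sup>2 > 0" using delta_range k_pos by (simp add: add_pos_pos)
    then show "(a_minus k \<delta>)\<^sup>2 = 2 * k * \<delta> + \<delta>\<^sup>2" "a_minus k \<delta> > 0" by (auto simp: a_minus_def)
  qed
  have plus_pos: "k\<^sup>2 - s\<^sup>2 > 0" if "s \<in> {0..a_plus k \<delta>}" for s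
  proof -
    have "s\<^sup>2 \<le> (a_plus k \<delta>)\<^sup>2" using that by (intro power_mono) auto
    moreover have "(k - \<delta>)\<^sup>2 > 0" using delta_range by simp
    ultimately show ?thesis unfolding a_plus_sq by (simp add: power2_eq_square algebra_simps)
  qed
  have minus_pos: "k\<^sup>2 + s\<^sup>2 > 0" for s using k_pos by (simp add: add_pos_nonneg)
  have q_plus: "q (1 * of_real s) = of_real (sqrt (k\<^sup>2 - s\<^sup>2))" if "s \<in> {0..a_plus k \<delta>}" for s
  proof -
    have "(of_real k)\<^sup>2 - (1 * of_real s)\<^sup>2 = (of_real (k\<^sup>2 - s\<^sup>2) :: complex)" by simp
    then show ?thesis using plus_pos[OF that] unfolding q_def by (simp only: of_real_sqrt less_imp_le)
  qed
  have q_minus: "q (\<i> * of_real s) = of_real (sqrt (k\<^sup>2 + s\<^sup>2))" for s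
  proof -
    have "(of_real k)\<^sup>2 - (\<i> * of_real s)\<^sup>2 = (of_real (k\<^sup>2 + s\<^sup>2) :: complex)"
      by (simp add: power_mult_distrib)
    then show ?thesis using minus_pos[of s] unfolding q_def by (simp only: of_real_sqrt less_imp_le)
  qed
  have ray_plus: "1 * of_real s \<in> W \<and> Im (\<phi> (1 * of_real s)) = 0" if s: "s \<in> {0..a_plus k \<delta>}" for s
    using q_plus[OF s] U_plus[of s] plus_pos[OF s] s
    by (simp add: W_def W0_def \<phi>_def flip: of_real_power)
  have ray_minus: "\<i> * of_real s \<in> W \<and> Im (\<phi> (\<i> * of_real s)) = 0" if s: "s \<in> {0..a_minus k \<delta>}" for s
    using q_minus[of s] U_minus[of s] minus_pos[of s] s
    by (simp add: W_def W0_def \<phi>_def power_mult_distrib flip: of_real_power)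

  (* At the far ends \<phi> takes the values -\<delta> and \<delta>, because k^2 - a_plus^2 = (k - \<delta>)^2 and
     k^2 + a_minus^2 = (k + \<delta>)^2. *)
  have K_end: "K j z = 0" if "Re (\<phi> z) = \<delta> \<or> Re (\<phi> z) = - \<delta>" for j z
    using D_at_end[OF that] by (simp add: K_def cutoff_deriv_def)
  have K_plus_end: "K j (1 * of_real (a_plus k \<delta>)) = 0" for j
  proof -
    have "k\<^sup>2 - (a_plus k \<delta>)\<^sup>2 = (k - \<delta>)\<^sup>2"
      unfolding a_plus_sq by (simp add: power2_eq_square algebra_simps)
    then have "q (1 * of_real (a_plus k \<delta>)) = of_real (k - \<delta>)"
      using q_plus[of "a_plus k \<delta>"] a_plus_pos delta_range by simp
    then show ?thesis by (intro K_end) (simp add: \<phi>_def)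
  qed
  have K_minus_end: "K j (\<i> * of_real (a_minus k \<delta>)) = 0" for j
  proof -
    have "k\<^sup>2 + (a_minus k \<delta>)\<^sup>2 = (k + \<delta>)\<^sup>2"
      unfolding a_minus_sq by (simp add: power2_eq_square algebra_simps)
    then have "q (\<i> * of_real (a_minus k \<delta>)) = of_real (k + \<delta>)"
      using q_minus[of "a_minus k \<delta>"] k_pos delta_range by simp
    then show ?thesis by (intro K_end) (simp add: \<phi>_def)
  qed

  have plus: "v_plus k \<delta> chi G R = ray_integral 1 (a_plus k \<delta>) (\<lambda>s. K 0 (1 * of_real s)) R" for R
    unfolding v_plus_def ray_integral_def mult_1_left
    by (intro integral_cong)
      (use q_plus in \<open>auto simp: K_def cutoff_deriv_def D0 h_def \<phi>_def mult.assoc\<close>)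
  have minus: "\<i> * v_minus k \<delta> chi G R
      = ray_integral \<i> (a_minus k \<delta>) (\<lambda>s. K 0 (\<i> * of_real s)) R" for R
  proof -
    have exp_real: "exp (\<i> * of_real R * \<i> * of_real s) = of_real (exp (- R * s))" for s :: real
    proof -
      have "\<i> * of_real R * \<i> * of_real s = of_real (- R * s)" by (simp add: complex_eq_iff)
      then show ?thesis by (simp only: exp_of_real)
    qed
    show ?thesis unfolding v_minus_def ray_integral_def exp_real
      by (simp add: K_def cutoff_deriv_def D0 h_def \<phi>_def q_minus)
  qed
  have "(\<lambda>R. ray_integral 1 (a_plus k \<delta>) (\<lambda>s. K 0 (1 * of_real s)) R
      - ray_integral \<i> (a_minus k \<delta>) (\<lambda>s. K 0 (\<i> * of_real s)) R)
      \<in> O[at_top](\<lambda>R. of_real (1 / R ^ N))"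
  proof (rule ray_integrals_difference_bigo[where f = "\<lambda>j s. K j (1 * of_real s)"
        and g = "\<lambda>j s. K j (\<i> * of_real s)"])
    show "((\<lambda>s. K j (1 * of_real s)) has_vector_derivative 1 * K (Suc j) (1 * of_real s))
        (at s within {0..a_plus k \<delta>})" if "s \<in> {0..a_plus k \<delta>}" for j s
      unfolding K_def
      by (rule cutoff_deriv_has_vector_derivative[where D = D and c = 1, OF D W \<phi> h a_plus_pos that ray_plus])
    show "((\<lambda>s. K j (\<i> * of_real s)) has_vector_derivative \<i> * K (Suc j) (\<i> * of_real s))
        (at s within {0..a_minus k \<delta>})" if "s \<in> {0..a_minus k \<delta>}" for j s
      unfolding K_def
      by (rule cutoff_deriv_has_vector_derivative[where D = D and c = "\<i>", OF D W \<phi> h a_minus_pos that ray_minus])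
  qed (use a_plus_pos a_minus_pos K_plus_end K_minus_end in auto)
  moreover have "v_at k \<delta> chi G R = \<i> / (4 * of_real pi) *
     (ray_integral 1 (a_plus k \<delta>) (\<lambda>s. K 0 (1 * of_real s)) R
      - ray_integral \<i> (a_minus k \<delta>) (\<lambda>s. K 0 (\<i> * of_real s)) R)" for R
    unfolding v_at_def plus[symmetric] minus[symmetric] by (simp add: field_simps)
  ultimately show ?thesis by simp
qed

end
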